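(* Let $N\ge 1$ be an integer and let $\omega_N=(x_1,\dots,x_N)$ be $N$ random initial states extracted independently according to the uniform probability measure $\mathbb{P}$ on $X$; let $\mathbb{P}^N$ denote the corresponding product probability measure on $X^N$. Let $O_k$, $S(k)$, $\theta_k(\omega_N)$ ($k\in\mathbb{Z}^+$) and $\bar t(\omega_N)$ be as defined in the context. Then, for any $\epsilon\in(0,1]$, $$\mathbb{P}^N\big(\{\omega_N\in X^N : S(\bar t(\omega_N))\ge \epsilon\}\big)\le \frac{1}{\epsilon}(1-\epsilon)^N .$$
   Context: $\mathbb{Z}^+$ denotes the set of non-negative integers. Consider the discrete-time system $x(t+1)=f(x(t))$, $t\in\mathbb{Z}^+$, where $f:\mathbb{R}^n\to\mathbb{R}^n$ is Borel measurable. $X\subseteq\mathbb{R}^n$ is a compact set of positive Lebesgue measure, and $\mathbb{P}$ is the uniform probability measure on the Borel $\sigma$-algebra of $X$. Write $\phi(t,x)$ for the state at time $t$ of the trajectory starting at $x$ at time $0$, i.e. $\phi(0,x)=x$, $\phi(t+1,x)=f(\phi(t,x))$. Define $O_0:=X$ and $O_{k+1}:=O_k\cap\{x: f(x)\in O_k\}$ for $k\in\mathbb{Z}^+$; equivalently $O_k=\{x\in X:\phi(\ell,x)\in X \text{ for all } \ell=1,\dots,k\}$. Define $S(k):=\mathbb{P}(O_k\setminus O_{k+1})$ for $k\in\mathbb{Z}^+$. For $\omega_N=(x_1,\dots,x_N)\in X^N$ define $$\theta_k(\omega_N):=\frac{1}{N}\sum_{i=1}^N \mathbf{1}_{O_k}(x_i),\quad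 k\in\mathbb{Z}^+,$$ where $\mathbf{1}_{O_k}$ is the indicator function of $O_k$, and $$\bar t(\omega_N):=\min\{k\in\mathbb{Z}^+:\theta_k(\omega_N)=\theta_{k+1}(\omega_N)\},$$ which is always finite because $(\theta_k(\omega_N))_k$ is non-increasing and takes finitely many values. *)

theory Defs
  imports "HOL-Probability.Probability"
begin

fun constr_set :: "('a \<Rightarrow> 'a) \<Rightarrow> 'a set \<Rightarrow> nat \<Rightarrow> 'a set" where
  "constr_set f X 0 = X"
| "constr_set f X (Suc k) = constr_set f X k \<inter> {x. f x \<in> constr_set f X k}"

text \<open>The state at time \<open>l\<close> of the trajectory starting at \<open>x\<close> is \<open>(f ^^ l) x\<close>.\<close>

lemma constr_set_eq: "constr_set f X k = {x \<in> X. \<forall>l\<in>{1..k}. (f ^^ l) x \<in> X}"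
proof -
  have "x \<in> constr_set f X k \<longleftrightarrow> (\<forall>l\<le>k. (f ^^ l) x \<in> X)" for x
  proof (induction k arbitrary: x)
    case 0
    then show ?case by simp
  next
    case (Suc k)
    have "x \<in> constr_set f X (Suc k) \<longleftrightarrow>
        (\<forall>l\<le>k. (f ^^ l) x \<in> X) \<and> (\<forall>l\<le>k. (f ^^ Suc l) x \<in> X)"
      using Suc.IH[of x] Suc.IH[of "f x"] by (simp add: funpow_swap1)
    also have "\<dots> \<longleftrightarrow> (\<forall>l\<le>Suc k. (f ^^ l) x \<in> X)"
    proof safe
      fix l assume "\<forall>l\<le>k. (f ^^ l) x \<in> X" "\<forall>l\<le>k. (f ^^ Suc l) x \<in> X" "l \<le> Suc k"
      then show "(f ^^ l) x \<in> X" by (cases l) (auto simp del: funpow.simps(2))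
    next
      fix l assume "\<forall>l\<le>Suc k. (f ^^ l) x \<in> X" "l \<le> k"
      then show "(f ^^ l) x \<in> X" "(f ^^ Suc l) x \<in> X"
        by (auto simp del: funpow.simps(2))
    qed
    finally show ?case .
  qed
  moreover have "(\<forall>l\<le>k. (f ^^ l) x \<in> X) \<longleftrightarrow> x \<in> X \<and> (\<forall>l\<in>{1..k}. (f ^^ l) x \<in> X)" for x
  proof safe
    assume "\<forall>l\<le>k. (f ^^ l) x \<in> X"
    then have "(f ^^ 0) x \<in> X" by blast
    then show "x \<in> X" by simp
  next
    fix l assume "x \<in> X" "\<forall>l\<in>{1..k}. (f ^^ l) x \<in> X" "l \<le> k"
    then show "(f ^^ l) x \<in> X" by (cases "l = 0") auto
  qed auto
  ultimately show ?thesis by auto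
qed

text \<open>The restriction makes \<open>X\<close> the whole space and the Borel subsets of \<open>X\<close>
  the measurable sets, so that the product measure below lives on \<open>X\<^sup>N\<close>.\<close>

definition unif :: "'a::euclidean_space set \<Rightarrow> 'a measure" where
  "unif X = uniform_measure (restrict_space lborel X) X"

definition unif_sample :: "nat \<Rightarrow> 'a::euclidean_space set \<Rightarrow> (nat \<Rightarrow> 'a) measure" where
  "unif_sample N X = PiM {1..N} (\<lambda>_. unif X)"

definition step_loss :: "('a::euclidean_space \<Rightarrow> 'a) \<Rightarrow> 'a set \<Rightarrow> nat \<Rightarrow> real" where
  "step_loss f X k = measure (unif X) (constr_set f X k - constr_set f X (Suc k))"

definition emp_frac :: "('a \<Rightarrow> 'a) \<Rightarrow> 'a set \<Rightarrow> nat \<Rightarrow> nat \<Rightarrow> (nat \<Rightarrow> 'a) \<Rightarrow> real" where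
  "emp_frac f X N k \<omega> = 1 / real N * (\<Sum>i=1..N. indicator (constr_set f X k) (\<omega> i))"

definition stop_time :: "('a \<Rightarrow> 'a) \<Rightarrow> 'a set \<Rightarrow> nat \<Rightarrow> (nat \<Rightarrow> 'a) \<Rightarrow> nat" where
  "stop_time f X N \<omega> = (LEAST k. emp_frac f X N k \<omega> = emp_frac f X N (Suc k) \<omega>)"

lemma stop_time_exists: "\<exists>k. emp_frac f X N k \<omega> = emp_frac f X N (Suc k) \<omega>"
proof -
  define A where "A k = {i \<in> {1..N}. \<omega> i \<in> constr_set f X k}" for k
  have eq: "emp_frac f X N k \<omega> = 1 / real N * real (card (A k))" for k
  proof -
    have "(\<Sum>i=1..N. indicator (constr_set f X k) (\<omega> i)) = (\<Sum>i\<in>A k. 1 :: real)"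
      unfolding A_def by (rule sum.mono_neutral_cong_right) (auto simp: indicator_def)
    then show ?thesis by (simp add: emp_frac_def)
  qed
  obtain k where "\<forall>j. card (A k) \<le> card (A j)"
    using ex_has_least_nat[of "\<lambda>_. True" 0 "\<lambda>k. card (A k)"] by auto
  moreover have "card (A (Suc k)) \<le> card (A k)"
    by (rule card_mono) (auto simp: A_def)
  ultimately have "card (A k) = card (A (Suc k))" by (simp add: le_antisym)
  then show ?thesis unfolding eq by metis
qed

lemma space_unif [simp]: "space (unif X) = X"
  by (simp add: unif_def space_restrict_space)

lemma sets_unif: "sets (unif X) = sets (restrict_space borel X)"
  by (simp add: unif_def sets_restrict_space)

lemma emeasure_unif:
  assumes "X \<in> sets borel" "A \<in> sets borel" "A \<subseteq> X"
  shows "emeasure (unif X) A = emeasure lborel A / emeasure lborel X"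
proof -
  have "A \<in> sets (restrict_space lborel X)" "X \<in> sets (restrict_space lborel X)"
    using assms by (auto simp: sets_restrict_space_iff)
  then show ?thesis
    using assms by (simp add: unif_def emeasure_restrict_space Int_absorb1)
qed

lemma prob_space_unif:
  assumes "compact X" "emeasure lborel X > 0"
  shows "prob_space (unif X)"
proof
  have X: "X \<in> sets borel" using assms(1) by (rule borel_compact)
  have "emeasure lborel X < \<infinity>"
    using assms(1) by (intro emeasure_bounded_finite compact_imp_bounded)
  then show "emeasure (unif X) (space (unif X)) = 1"
    using emeasure_unif[OF X X] assms(2) by (simp add: less_top)
qed

lemma space_unif_sample: "space (unif_sample N X) = {1..N} \<rightarrow>\<^sub>E X"
  by (simp add: unif_sample_def space_PiM)

lemma constr_set_borel:
  assumes "f \<in> borel_measurable borel" "X \<in> sets borel"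
  shows "constr_set f X k \<in> sets borel"
proof (induction k)
  case 0
  then show ?case using assms by simp
next
  case (Suc k)
  have "f -` constr_set f X k \<inter> space borel \<in> sets borel"
    using assms(1) Suc.IH by (rule measurable_sets)
  then show ?case using Suc.IH by (simp add: vimage_def)
qed

lemma bad_event_measurable:
  assumes "f \<in> borel_measurable borel" "X \<in> sets borel"
  shows "{\<omega> \<in> space (unif_sample N X). step_loss f X (stop_time f X N \<omega>) \<ge> \<epsilon>}
    \<in> sets (unif_sample N X)"
proof -
  have ind: "indicator (constr_set f X k) \<in> unif X \<rightarrow>\<^sub>M (borel :: real measure)" for k
    using constr_set_borel[OF assms, of k]
    by (subst measurable_cong_sets[OF sets_unif refl]) (intro measurable_restrict_space1, simp)
  have emp: "emp_frac f X N k \<in> borel_measurable (unif_sample N X)" for k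
  proof -
    have "(\<lambda>\<omega>. indicator (constr_set f X k) (\<omega> i) :: real) \<in> borel_measurable (unif_sample N X)"
      if "i \<in> {1..N}" for i
      unfolding unif_sample_def
      using measurable_compose[where g = "indicator (constr_set f X k)",
          OF measurable_component_singleton[where M = "\<lambda>_. unif X", OF that] ind] .
    then show ?thesis
      unfolding emp_frac_def
      by (intro borel_measurable_times borel_measurable_const borel_measurable_sum)
  qed
  have pred: "Measurable.pred (unif_sample N X)
      (\<lambda>\<omega>. emp_frac f X N k \<omega> = emp_frac f X N (Suc k) \<omega>)" for k
    unfolding pred_def by (rule borel_measurable_eq[OF emp emp])
  have stop: "stop_time f X N \<in> unif_sample N X \<rightarrow>\<^sub>M count_space UNIV"
    unfolding stop_time_def by (rule measurable_Least) (rule pred)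
  have "Measurable.pred (unif_sample N X) (\<lambda>\<omega>. step_loss f X (stop_time f X N \<omega>) \<ge> \<epsilon>)"
    by (rule measurable_compose[OF stop]) simp
  then show ?thesis by (simp add: pred_def)
qed

end

(* The layers D k = O k - O (k + 1) are disjoint, so at most 1 / \<epsilon> of them have probability at least \<epsilon>.
   If the stopping time equals k, then no sample point lies in D k, an event of probability
   (1 - S k) ^ N.  The union bound over the large layers gives the claim. *)
theory Submission
  imports Defs
begin

text \<open>Probabilities of disjoint events add up to at most 1, and each member contributes at
  least \<epsilon>. Finiteness is a separate conclusion because \<open>card\<close> of an infinite
  set is 0, which would make the second bound vacuous.\<close>

lemma (in prob_space) card_large_disjoint_events:
  assumes A: "\<And>i. i \<in> I \<Longrightarrow> A i \<in> events" and disj: "disjoint_family_on A I"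
    and large: "\<And>i. i \<in> I \<Longrightarrow> prob (A i) \<ge> \<epsilon>" and "\<epsilon> > 0"
  shows "finite I" "real (card I) \<le> 1 / \<epsilon>"
proof -
  have bound: "real (card J) \<le> 1 / \<epsilon>" if "J \<subseteq> I" "finite J" for J
  proof -
    have "real (card J) * \<epsilon> \<le> (\<Sum>i\<in>J. prob (A i))"
      using that large by (intro sum_bounded_below) auto
    also have "\<dots> = prob (\<Union>i\<in>J. A i)"
      using that A disj
      by (intro finite_measure_finite_Union[symmetric]) (auto intro: disjoint_family_on_mono)
    also have "\<dots> \<le> 1" by simp
    finally show ?thesis using \<open>\<epsilon> > 0\<close> by (simp add: field_simps)
  qed
  show fin: "finite I"
  proof (rule ccontr)
    assume "infinite I"
    \<comment> \<open>One more than the integer part of 1 / \<epsilon> already exceeds the bound for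
      finite subfamilies.\<close>
    then obtain J where "J \<subseteq> I" "finite J" "card J = Suc (nat \<lfloor>1 / \<epsilon>\<rfloor>)"
      using infinite_arbitrarily_large by blast
    with bound[of J] show False by linarith
  qed
  show "real (card I) \<le> 1 / \<epsilon>" by (rule bound[OF subset_refl fin])
qed

lemma constr_set_antimono: "j \<le> k \<Longrightarrow> constr_set f X k \<subseteq> constr_set f X j"
  by (induction k rule: dec_induct) auto

text \<open>For \<open>j < k\<close>, nesting puts the layer of \<open>k\<close> inside
  \<open>constr_set f X (Suc j)\<close>, which the layer of \<open>j\<close> excludes.\<close>

lemma disjoint_family_constr_set_layers:
  "disjoint_family (\<lambda>k. constr_set f X k - constr_set f X (Suc k))"
  unfolding disjoint_family_on_def
proof (intro ballI impI)
  have less: "(constr_set f X j - constr_set f X (Suc j)) \<inter>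
      (constr_set f X k - constr_set f X (Suc k)) = {}" if "j < k" for j k
    using constr_set_antimono[of "Suc j" k f X] that by auto
  fix j k :: nat assume "j \<noteq> k"
  then show "(constr_set f X j - constr_set f X (Suc j)) \<inter>
      (constr_set f X k - constr_set f X (Suc k)) = {}"
    using less[of j k] less[of k j] by (cases "j < k") auto
qed

text \<open>Equal consecutive fractions make the layer's indicators sum to zero over the sample, and
  a vanishing sum of nonnegative terms has only zero terms.\<close>

lemma stop_time_avoids_layer:
  assumes "i \<in> {1..N}"
  shows "\<omega> i \<notin> constr_set f X (stop_time f X N \<omega>) - constr_set f X (Suc (stop_time f X N \<omega>))"
proof -
  define k where "k = stop_time f X N \<omega>"
  define D where "D = constr_set f X k - constr_set f X (Suc k)"
  have "emp_frac f X N k \<omega> = emp_frac f X N (Suc k) \<omega>"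
    unfolding k_def stop_time_def by (rule LeastI_ex) (rule stop_time_exists)
  then have "(\<Sum>i=1..N. indicator (constr_set f X k) (\<omega> i) :: real) =
      (\<Sum>i=1..N. indicator (constr_set f X (Suc k)) (\<omega> i))"
    \<comment> \<open>The index \<open>i\<close> shows \<open>N > 0\<close>, so the factor
      \<open>1 / real N\<close> cancels.\<close>
    using assms by (simp add: emp_frac_def del: constr_set.simps)
  moreover have "(indicator D x :: real) =
      indicator (constr_set f X k) x - indicator (constr_set f X (Suc k)) x" for x
    by (auto simp: D_def indicator_def)
  ultimately have "(\<Sum>i=1..N. indicator D (\<omega> i) :: real) = 0"
    by (simp add: sum_subtractf del: constr_set.simps)
  then have "indicator D (\<omega> i) = (0 :: real)"
    using assms by (subst (asm) sum_nonneg_eq_0_iff) auto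
  then show ?thesis by (simp add: D_def k_def indicator_eq_0_iff del: constr_set.simps)
qed

theorem theorem1:
  fixes f :: "real ^ 'n \<Rightarrow> real ^ 'n" and X :: "(real ^ 'n) set"
    and N :: nat and \<epsilon> :: real
  assumes "f \<in> borel_measurable borel"
    and "compact X" and "emeasure lborel X > 0"
    and "N \<ge> 1"
    and "\<epsilon> \<in> {0<..1}"
  shows "measure (unif_sample N X)
      {\<omega> \<in> space (unif_sample N X). step_loss f X (stop_time f X N \<omega>) \<ge> \<epsilon>}
    \<le> 1 / \<epsilon> * (1 - \<epsilon>) ^ N"
proof -
  define D where "D k = constr_set f X k - constr_set f X (Suc k)" for k
  define K where "K = {k. step_loss f X k \<ge> \<epsilon>}"
  define B where "B k = Pi\<^sub>E {1..N} (\<lambda>_. X - D k)" for k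
  interpret U: prob_space "unif X" using assms(2,3) by (rule prob_space_unif)
  interpret P: finite_product_prob_space "\<lambda>_. unif X" "{1..N}"
    by unfold_locales auto
  have sample: "unif_sample N X = PiM {1..N} (\<lambda>_. unif X)" by (simp add: unif_sample_def)
  have X: "X \<in> sets borel" using assms(2) by (rule borel_compact)
  have D: "D k \<in> sets (unif X)" for k
    \<comment> \<open>Index 0 in the antimonotonicity gives containment in \<open>X\<close>, as the
      restricted sigma-algebra demands.\<close>
    using constr_set_borel[OF assms(1) X] constr_set_antimono[of 0 k f X] X
    by (auto simp: sets_unif sets_restrict_space_iff D_def simp del: constr_set.simps(2))
  have S: "step_loss f X k = U.prob (D k)" for k
    by (simp add: step_loss_def D_def)
  have disj: "disjoint_family_on D K"
    unfolding D_def
    by (rule disjoint_family_on_mono[OF subset_UNIV disjoint_family_constr_set_layers])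
  have K: "finite K" "real (card K) \<le> 1 / \<epsilon>"
    using U.card_large_disjoint_events[of K D \<epsilon>, OF D disj] assms(5) by (auto simp: K_def S)
  have B: "B k \<in> P.events" for k
    unfolding B_def using sets.compl_sets[OF D] by (intro sets_PiM_I_finite) auto
  have prob_B: "P.prob (B k) \<le> (1 - \<epsilon>) ^ N" if "k \<in> K" for k
  proof -
    \<comment> \<open>Independence: \<open>B k\<close> is a rectangle with \<open>N\<close> equal
      sides, each the complement of \<open>D k\<close> in \<open>X\<close>.\<close>
    have "P.prob (B k) = (1 - U.prob (D k)) ^ N"
      using P.prob_times[of "\<lambda>_. X - D k"] sets.compl_sets[OF D] U.prob_compl[OF D]
      by (simp add: B_def)
    also have "\<dots> \<le> (1 - \<epsilon>) ^ N"
      using that by (intro power_mono) (auto simp: K_def S)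
    finally show ?thesis .
  qed
  \<comment> \<open>The sample-dependent index is traded for a union over the fixed set
    \<open>K\<close>: each bad \<omega> lies in \<open>B k\<close> for \<open>k\<close> its own
    stopping time.\<close>
  have "{\<omega> \<in> space (unif_sample N X). step_loss f X (stop_time f X N \<omega>) \<ge> \<epsilon>} \<subseteq> (\<Union>k\<in>K. B k)"
  proof safe
    fix \<omega> assume \<omega>: "\<omega> \<in> space (unif_sample N X)"
      and large: "step_loss f X (stop_time f X N \<omega>) \<ge> \<epsilon>"
    have "\<omega> i \<notin> D (stop_time f X N \<omega>)" if "i \<in> {1..N}" for i
      unfolding D_def using that by (rule stop_time_avoids_layer)
    with \<omega> have "\<omega> \<in> B (stop_time f X N \<omega>)"
      by (simp add: B_def space_unif_sample PiE_iff)
    with large show "\<omega> \<in> (\<Union>k\<in>K. B k)"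
      unfolding K_def by blast
  qed
  then have "measure (unif_sample N X)
      {\<omega> \<in> space (unif_sample N X). step_loss f X (stop_time f X N \<omega>) \<ge> \<epsilon>} \<le> P.prob (\<Union>k\<in>K. B k)"
    unfolding sample using B K(1) by (intro P.finite_measure_mono) auto
  also have "\<dots> \<le> (\<Sum>k\<in>K. P.prob (B k))"
    using B K(1) by (intro P.finite_measure_subadditive_finite) auto
  also have "\<dots> \<le> real (card K) * (1 - \<epsilon>) ^ N"
    using prob_B by (intro sum_bounded_above) auto
  \<comment> \<open>Here \<epsilon> \<le> 1 makes the common factor nonnegative.\<close>
  also have "\<dots> \<le> 1 / \<epsilon> * (1 - \<epsilon>) ^ N"
    using K(2) assms(5) by (intro mult_right_mono) auto
  finally show ?thesis .
qed

end
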